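(* Let $u=u(t,x)\in\mathbb{R}^n$ be a piecewise Lipschitz continuous solution of the system $u_t+f(u)_x=0$ on $\mathbb{R}$ with finitely many discontinuities, and let $x=x_\alpha(t)$ be one of them, belonging to the $k_\alpha$-th characteristic family, with one-sided limits $u^\pm=\lim_{x\to x_\alpha(t)^\pm}u(t,x)$, $u^+\neq u^-$. Let $\xi_\alpha=\xi_\alpha(t)$ be a differentiable real function of time, let $v=v(t,x)\in\mathbb{R}^n$ be a function defined on both sides of the curve $x=x_\alpha(t)$, put $w_\alpha=v+\xi_\alpha u_x$, and let $w_\alpha^\pm\in\mathbb{R}^n$ be the one-sided limits of $w_\alpha$ at $x=x_\alpha(t)^\pm$ (assumed to exist). Then, at each time $t$: (1) The equation $$\xi_\alpha'(t)=D\lambda_{k_\alpha}(u^+,u^-)(w_\alpha^+,w_\alpha^-)$$ is equivalent to the relation $$\xi_\alpha'=\Big\langle l_{k_\alpha}(u^+,u^-),\ [A(u^+)-\bar A(u^+,u^-)]\,w_\alpha^+ + [\bar A(u^+,u^-)-A(u^-)]\,w_\alpha^-\Big\rangle,$$ where $l_{k_\alpha}(u^+,u^-)$ is the left eigenvector of $\bar A(u^+,u^-)$ for the eigenvalue $\lambda_{k_\alpha}(u^+,u^-)$ satisfying $\langle l_{k_\alpha}(u^+,u^-),u^+-u^-\rangle=1$. (2) If the relation $$x_\alpha' w_\alpha^+-A(u^+)w_\alpha^+ +\xi_\alpha' u^+ = x_\alpha' w_\alpha^- -A(u^-)w_\alpha^- +\xi_\alpha' u^-$$ holds, then the interface conditions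 $$\langle l_i(u^+,u^-),\,w_\alpha^+-w_\alpha^-\rangle+\langle Dl_i(u^+,u^-)(w_\alpha^+,w_\alpha^-),\,u^+-u^-\rangle=0\qquad\text{for all } i\neq k_\alpha$$ are satisfied. Moreover, the relation assumed in (2) implies that the flux $A(u)w_\alpha-x_\alpha' w_\alpha-\xi_\alpha' u$ of the equation $$\partial_t w_\alpha+\partial_y\big[A(u)w_\alpha-x_\alpha' w_\alpha-\xi_\alpha' u\big]=0,\qquad y=x-x_\alpha(t),$$ is continuous at $y=0$ (its one-sided limits at $y=0^\pm$ coincide).
   Context: The flux $f:\mathbb{R}^n\to\mathbb{R}^n$ is smooth, $A(u)=f_u(u)$ is its Jacobian matrix, and the system $u_t+f(u)_x=0$ is strictly hyperbolic ($A(u)$ has $n$ real distinct eigenvalues), each characteristic field being either linearly degenerate or genuinely nonlinear in the sense of Lax. For $u,v\in\mathbb{R}^n$ define $$\bar A(u,v)=\int_0^1 A(\theta u+(1-\theta)v)\,d\theta .$$ It is assumed that $\bar A(u,v)$ has real distinct eigenvalues $\lambda_1(u,v)<\dots<\lambda_n(u,v)$ and that the ranges of the functions $\lambda_i(u,v)$, $i=1,\dots,n$, do not overlap. The corresponding left eigenvectors (row vectors) are $l_i(u,v)$, i.e. $l_i(u,v)\bar A(u,v)=\lambda_i(u,v)\,l_i(u,v)$; the functions $\lambda_i(u,v)$ and $l_i(u,v)$ are $C^1$ in $(u,v)$. That the discontinuity at $x=x_\alpha(t)$ belongs to the $k_\alpha$-th characteristic family means that the Rankine–Hugoniot and entropy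 admissibility conditions hold in the form $$x_\alpha'(t)=\lambda_{k_\alpha}(u^+,u^-),\qquad \langle l_i(u^+,u^-),u^+-u^-\rangle=0\ \text{ for all } i\neq k_\alpha,$$ $$\lambda_{k_\alpha}(u^+,u^+)\le\lambda_{k_\alpha}(u^+,u^-)\le\lambda_{k_\alpha}(u^-,u^-).$$ For a $C^1$ function $g(u,v)$ (scalar or vector valued), $Dg(u^+,u^-)(w^+,w^-)$ denotes the directional derivative of $g$ at $(u^+,u^-)$ in the direction $(w^+,w^-)$, i.e. $\sum_m \frac{\partial g}{\partial u_m^+}w_m^+ +\sum_m\frac{\partial g}{\partial u_m^-}w_m^-$, where $\partial/\partial u^+$ and $\partial/\partial u^-$ are derivatives in the first and second argument, respectively. $\langle\cdot,\cdot\rangle$ is the Euclidean pairing, and primes denote $d/dt$. *)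

theory Defs
  imports "HOL-Analysis.Analysis"
begin

primrec Ck :: "nat \<Rightarrow> ('a::real_normed_vector \<Rightarrow> 'b::real_normed_vector) \<Rightarrow> bool" where
  "Ck 0 g \<longleftrightarrow> continuous_on UNIV g"
| "Ck (Suc k) g \<longleftrightarrow> (\<forall>x. g differentiable (at x)) \<and>
     (\<forall>h. Ck k (\<lambda>x. frechet_derivative g (at x) h))"

definition smooth :: "('a::real_normed_vector \<Rightarrow> 'b::real_normed_vector) \<Rightarrow> bool" where
  "smooth g \<longleftrightarrow> (\<forall>k. Ck k g)"

definition is_eigenvalue :: "real^'n^'n \<Rightarrow> real \<Rightarrow> bool" where
  "is_eigenvalue M c \<longleftrightarrow> (\<exists>r. r \<noteq> 0 \<and> M *v r = c *\<^sub>R r)"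

definition is_left_eigenvector :: "real^'n^'n \<Rightarrow> real \<Rightarrow> real^'n \<Rightarrow> bool" where
  "is_left_eigenvector M c l \<longleftrightarrow> l \<noteq> 0 \<and> l v* M = c *\<^sub>R l"

abbreviation A_mat :: "(real^'n \<Rightarrow> real^'n) \<Rightarrow> real^'n \<Rightarrow> real^'n^'n" where
  "A_mat f u \<equiv> jacobian f (at u)"

definition A_bar :: "(real^'n \<Rightarrow> real^'n) \<Rightarrow> real^'n \<Rightarrow> real^'n \<Rightarrow> real^'n^'n" where
  "A_bar f u v = integral {0..1} (\<lambda>\<theta>. A_mat f (\<theta> *\<^sub>R u + (1 - \<theta>) *\<^sub>R v))"

definition strictly_hyperbolic :: "(real^'n \<Rightarrow> real^'n) \<Rightarrow> bool" where
  "strictly_hyperbolic f \<longleftrightarrow> (\<forall>u. card {c. is_eigenvalue (A_mat f u) c} = CARD('n))"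

text \<open>In the next two definitions \<open>\<mu> u\<close> is an eigenvalue of the Jacobian at \<open>u\<close>.
  Its eigenspace is one-dimensional under strict hyperbolicity, so quantifying over all
  right eigenvectors is independent of a choice of one.\<close>

definition linearly_degenerate :: "(real^'n \<Rightarrow> real^'n) \<Rightarrow> (real^'n \<Rightarrow> real) \<Rightarrow> bool" where
  "linearly_degenerate f \<mu> \<longleftrightarrow>
     (\<forall>u r. r \<noteq> 0 \<and> A_mat f u *v r = \<mu> u *\<^sub>R r \<longrightarrow> frechet_derivative \<mu> (at u) r = 0)"

definition genuinely_nonlinear :: "(real^'n \<Rightarrow> real^'n) \<Rightarrow> (real^'n \<Rightarrow> real) \<Rightarrow> bool" where
  "genuinely_nonlinear f \<mu> \<longleftrightarrow>
     (\<forall>u r. r \<noteq> 0 \<and> A_mat f u *v r = \<mu> u *\<^sub>R r \<longrightarrow> frechet_derivative \<mu> (at u) r \<noteq> 0)"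

text \<open>Eigenvalues and left eigenvectors are indexed by \<open>1, \<dots>, n\<close> and are functions of the pair
  \<open>(u, v)\<close>, so that \<open>Dg(u, v)(w, z)\<close> is \<open>frechet_derivative g (at (u, v)) (w, z)\<close>.\<close>

definition averaged_eigenstructure ::
  "(real^'n \<Rightarrow> real^'n) \<Rightarrow> (nat \<Rightarrow> (real^'n) \<times> (real^'n) \<Rightarrow> real) \<Rightarrow>
   (nat \<Rightarrow> (real^'n) \<times> (real^'n) \<Rightarrow> real^'n) \<Rightarrow> bool" where
  "averaged_eigenstructure f lam l \<longleftrightarrow>
     (\<forall>u v. \<forall>i\<in>{1..CARD('n)}. is_eigenvalue (A_bar f u v) (lam i (u, v))) \<and>
     (\<forall>p. strict_mono_on {1..CARD('n)} (\<lambda>i. lam i p)) \<and>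
     (\<forall>i\<in>{1..CARD('n)}. \<forall>j\<in>{1..CARD('n)}. i \<noteq> j \<longrightarrow> range (lam i) \<inter> range (lam j) = {}) \<and>
     (\<forall>u v. \<forall>i\<in>{1..CARD('n)}. is_left_eigenvector (A_bar f u v) (lam i (u, v)) (l i (u, v))) \<and>
     (\<forall>i\<in>{1..CARD('n)}. Ck 1 (lam i) \<and> Ck 1 (l i))"

text \<open>Since \<open>A_bar f u u = A_mat f u\<close>, the \<open>i\<close>-th characteristic speed at \<open>u\<close> is \<open>lam i (u, u)\<close>.\<close>

definition lax_fields ::
  "(real^'n \<Rightarrow> real^'n) \<Rightarrow> (nat \<Rightarrow> (real^'n) \<times> (real^'n) \<Rightarrow> real) \<Rightarrow> bool" where
  "lax_fields f lam \<longleftrightarrow> (\<forall>i\<in>{1..CARD('n)}.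
     linearly_degenerate f (\<lambda>u. lam i (u, u)) \<or> genuinely_nonlinear f (\<lambda>u. lam i (u, u)))"

definition weak_solution ::
  "(real^'n \<Rightarrow> real^'n) \<Rightarrow> real set \<Rightarrow> (real \<Rightarrow> real \<Rightarrow> real^'n) \<Rightarrow> bool" where
  "weak_solution f T u \<longleftrightarrow>
     (\<forall>\<phi> :: real \<times> real \<Rightarrow> real.
        smooth \<phi> \<and> (\<exists>K. compact K \<and> K \<subseteq> T \<times> UNIV \<and> (\<forall>p. p \<notin> K \<longrightarrow> \<phi> p = 0)) \<longrightarrow>
        ((\<lambda>(t, x). frechet_derivative \<phi> (at (t, x)) (1, 0) *\<^sub>R u t x
                 + frechet_derivative \<phi> (at (t, x)) (0, 1) *\<^sub>R f (u t x))
          has_integral 0) (T \<times> UNIV))"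

text \<open>The discontinuities lie on the finitely many curves \<open>x = X \<beta> t\<close>, \<open>\<beta> \<in> B\<close>; \<open>u\<close> is Lipschitz
  on each of the regions into which these curves divide \<open>T \<times> \<real>\<close>.\<close>

definition piecewise_lipschitz ::
  "real set \<Rightarrow> 'b set \<Rightarrow> ('b \<Rightarrow> real \<Rightarrow> real) \<Rightarrow> (real \<Rightarrow> real \<Rightarrow> 'a::metric_space) \<Rightarrow> bool" where
  "piecewise_lipschitz T B X u \<longleftrightarrow> finite B \<and> (\<forall>\<beta>\<in>B. continuous_on T (X \<beta>)) \<and>
     (\<forall>C\<in>components (T \<times> UNIV - {(t, x). \<exists>\<beta>\<in>B. x = X \<beta> t}).
        \<exists>L. L-lipschitz_on C (\<lambda>(t, x). u t x))"

definition belongs_to_family ::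
  "(nat \<Rightarrow> (real^'n) \<times> (real^'n) \<Rightarrow> real) \<Rightarrow> (nat \<Rightarrow> (real^'n) \<times> (real^'n) \<Rightarrow> real^'n) \<Rightarrow>
   nat \<Rightarrow> (real \<Rightarrow> real) \<Rightarrow> real \<Rightarrow> real^'n \<Rightarrow> real^'n \<Rightarrow> bool" where
  "belongs_to_family lam l k xc t up um \<longleftrightarrow>
     (xc has_real_derivative lam k (up, um)) (at t) \<and>
     (\<forall>i\<in>{1..CARD('n)}. i \<noteq> k \<longrightarrow> l i (up, um) \<bullet> (up - um) = 0) \<and>
     lam k (up, up) \<le> lam k (up, um) \<and> lam k (up, um) \<le> lam k (um, um)"

text \<open>The derivative \<open>u\<^sub>x\<close> of a piecewise Lipschitz function exists only almost everywhere, and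
  \<open>w = v + \<xi> u\<^sub>x\<close> makes sense only where it does. One-sided limits of expressions involving \<open>w\<close>
  are therefore taken along the points \<open>x\<close> at which \<open>u t\<close> is differentiable. Off the
  discontinuities these have full measure, so they accumulate at the curve from both sides.\<close>

definition w_var ::
  "(real \<Rightarrow> real \<Rightarrow> 'a::real_normed_vector) \<Rightarrow> (real \<Rightarrow> real \<Rightarrow> 'a) \<Rightarrow> (real \<Rightarrow> real) \<Rightarrow>
   real \<Rightarrow> real \<Rightarrow> 'a" where
  "w_var u v \<xi> t x = v t x + \<xi> t *\<^sub>R vector_derivative (u t) (at x)"

definition diff_right :: "(real \<Rightarrow> 'a::real_normed_vector) \<Rightarrow> real \<Rightarrow> real filter" where
  "diff_right g a = at a within {x. a < x \<and> g differentiable (at x)}"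

definition diff_left :: "(real \<Rightarrow> 'a::real_normed_vector) \<Rightarrow> real \<Rightarrow> real filter" where
  "diff_left g a = at a within {x. x < a \<and> g differentiable (at x)}"

text \<open>The flux of the equation for \<open>w\<close> in the moving coordinate \<open>y = x - xc t\<close>.\<close>

definition moving_flux ::
  "(real^'n \<Rightarrow> real^'n) \<Rightarrow> (real \<Rightarrow> real \<Rightarrow> real^'n) \<Rightarrow> (real \<Rightarrow> real \<Rightarrow> real^'n) \<Rightarrow>
   (real \<Rightarrow> real) \<Rightarrow> (real \<Rightarrow> real) \<Rightarrow> real \<Rightarrow> real \<Rightarrow> real^'n" where
  "moving_flux f u w xc \<xi> t y =
     A_mat f (u t (xc t + y)) *v w t (xc t + y)
     - deriv xc t *\<^sub>R w t (xc t + y) - deriv \<xi> t *\<^sub>R u t (xc t + y)"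

end

theory Submission
  imports Defs
begin

text \<open>Put \<open>d = u\<^sup>+ - u\<^sup>-\<close>. Since \<open>A_bar f u v *v (u - v) = f u - f v\<close>, every pair \<open>(u, v)\<close> satisfies
  \<open>l i \<bullet> (f u - f v) = lam i * (l i \<bullet> (u - v))\<close>. Both parts come from differentiating
  this scalar identity at \<open>(u\<^sup>+, u\<^sup>-)\<close>, which avoids differentiating \<open>A_bar\<close>. The left
  eigenvectors form a basis, so the orthogonality conditions force \<open>l k \<bullet> d \<noteq> 0\<close> and
  \<open>f u\<^sup>+ - f u\<^sup>- = lam k *\<^sub>R d\<close>.\<close>

section \<open>Left eigenvectors as a basis\<close>

text \<open>Applying \<open>T\<close> to the relation and subtracting \<open>\<mu> a\<close> times
  the relation eliminates \<open>L a\<close>. The remaining coefficients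
  \<open>c i * (\<mu> i - \<mu> a)\<close> vanish by induction, and their second factors are
  nonzero.\<close>

lemma eigenvectors_sum_eq_0:
  fixes L :: "'i \<Rightarrow> 'a::real_vector"
  assumes "finite S" "linear T" "\<And>i. i \<in> S \<Longrightarrow> T (L i) = \<mu> i *\<^sub>R L i"
    and "\<And>i. i \<in> S \<Longrightarrow> L i \<noteq> 0" "inj_on \<mu> S" "(\<Sum>i\<in>S. c i *\<^sub>R L i) = 0"
  shows "\<forall>i\<in>S. c i = 0"
  using assms(1,3-)
proof (induction S arbitrary: c)
  case empty
  then show ?case by simp
next
  case (insert a S)
  interpret T: linear T by fact
  have s: "c a *\<^sub>R L a + (\<Sum>i\<in>S. c i *\<^sub>R L i) = 0"
    using insert by simp
  have T_sum: "T (\<Sum>i\<in>S. c i *\<^sub>R L i) = (\<Sum>i\<in>S. (c i * \<mu> i) *\<^sub>R L i)"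
    by (simp add: T.sum T.scale insert.prems(1))
  have "T (c a *\<^sub>R L a + (\<Sum>i\<in>S. c i *\<^sub>R L i)) = 0"
    using s T.zero by simp
  then have "(c a * \<mu> a) *\<^sub>R L a + (\<Sum>i\<in>S. (c i * \<mu> i) *\<^sub>R L i) = 0"
    by (simp add: T.add T_sum T.scale insert.prems(1))
  moreover have "\<mu> a *\<^sub>R (c a *\<^sub>R L a + (\<Sum>i\<in>S. c i *\<^sub>R L i)) = 0"
    using s by simp
  ultimately have "(\<Sum>i\<in>S. (c i * \<mu> i) *\<^sub>R L i) - \<mu> a *\<^sub>R (\<Sum>i\<in>S. c i *\<^sub>R L i) = 0"
    by (simp add: scaleR_add_right mult.commute) (metis add_left_cancel)
  then have "(\<Sum>i\<in>S. (c i * (\<mu> i - \<mu> a)) *\<^sub>R L i) = 0"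
    by (simp add: scaleR_sum_right sum_subtractf right_diff_distrib scaleR_left_diff_distrib mult.commute)
  then have "\<forall>i\<in>S. c i * (\<mu> i - \<mu> a) = 0"
    using insert by (intro insert.IH) auto
  moreover have "\<mu> i \<noteq> \<mu> a" if "i \<in> S" for i
    using that insert by (auto simp: inj_on_def)
  ultimately have "\<forall>i\<in>S. c i = 0"
    by simp
  then show ?case
    using s insert.prems(2) by simp
qed

text \<open>As many eigenvectors as the dimension, with distinct eigenvalues, span the whole space,
  so \<open>d\<close> is orthogonal to itself. The family \<open>L\<close> is left arbitrary so that
  one eigenvector can be exchanged for another.\<close>

lemma orthogonal_left_eigenvectors_eq_0:
  fixes M :: "real^'n^'n"
  assumes ev: "\<And>i. i \<in> S \<Longrightarrow> is_left_eigenvector M (\<mu> i) (L i)"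
    and S: "finite S" "card S = CARD('n)" and inj: "inj_on \<mu> S"
    and orth: "\<And>i. i \<in> S \<Longrightarrow> L i \<bullet> d = 0"
  shows "d = 0"
proof -
  have lin: "linear (\<lambda>x. x v* M)"
    by (rule linearI) (simp_all add: vector_matrix_left_distrib scaleR_vector_matrix_assoc)
  have ev0: "L i \<noteq> 0" "L i v* M = \<mu> i *\<^sub>R L i" if "i \<in> S" for i
    using ev[OF that] by (auto simp: is_left_eigenvector_def)
  \<comment> \<open>A nonzero vector determines its eigenvalue. Injectivity lets sums over the image
    be reindexed by \<open>S\<close> and gives the image full cardinality.\<close>
  have injL: "inj_on L S"
  proof (rule inj_onI)
    fix i j assume ij: "i \<in> S" "j \<in> S" "L i = L j"
    then have "\<mu> i *\<^sub>R L i = \<mu> j *\<^sub>R L i"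
      using ev0(2) by metis
    then show "i = j"
      using ij ev0(1) inj by (simp add: inj_on_eq_iff)
  qed
  have "independent (L ` S)"
  proof (rule independent_if_scalars_zero)
    show "g x = 0" if "(\<Sum>x\<in>L ` S. g x *\<^sub>R x) = 0" "x \<in> L ` S" for g x
      using eigenvectors_sum_eq_0[OF S(1) lin, of L \<mu> "g \<circ> L"] that ev0 inj
      by (auto simp: sum.reindex[OF injL])
  qed (use S in simp)
  then have "dim (L ` S) = DIM(real^'n)"
    using S injL by (simp add: dim_eq_card_independent card_image)
  then have "span (L ` S) = UNIV"
    by (rule dim_eq_full[THEN iffD1])
  then have "orthogonal d d"
    using orth by (intro orthogonal_to_span[of d "L ` S"]) (auto simp: orthogonal_def inner_commute)
  then show ?thesis
    by (simp add: orthogonal_def)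
qed

section \<open>Calculus of the flux and its averaged Jacobian\<close>

lemma Ck_1D:
  assumes "Ck 1 g"
  shows "(g has_derivative frechet_derivative g (at x)) (at x)"
    and "continuous_on UNIV (\<lambda>x. frechet_derivative g (at x) h)"
  using assms by (auto simp: frechet_derivative_works)

text \<open>Each entry of the Jacobian is a component of a directional derivative along a coordinate
  axis, and \<open>Ck 1\<close> makes these continuous.\<close>

lemma continuous_on_A_mat:
  fixes f :: "real^'n \<Rightarrow> real^'n"
  assumes "Ck 1 f"
  shows "continuous_on UNIV (A_mat f)"
proof -
  have "continuous_on UNIV (\<lambda>u. frechet_derivative f (at u) (axis j 1) $ i)" for i j
    by (intro continuous_on_component Ck_1D(2) assms)
  then show ?thesis
    unfolding jacobian_def matrix_def by (intro continuous_on_vec_lambda)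
qed

lemma has_derivative_A_mat:
  assumes "Ck 1 f"
  shows "(f has_derivative (*v) (A_mat f u)) (at u)"
  using assms by (metis Ck_1D(1) differentiableI jacobian_works)

lemma bounded_linear_matrix_vector_mult_left:
  fixes x :: "real^'n"
  shows "bounded_linear (\<lambda>M :: real^'n^'m. M *v x)"
  by (rule linear_conv_bounded_linear[THEN iffD1], rule linearI)
    (rule matrix_vector_mult_add_rdistrib, rule scaleR_matrix_vector_assoc[symmetric])

text \<open>Fundamental theorem of calculus for \<open>f\<close> along the segment from
  \<open>v\<close> to \<open>u\<close>; the product with the fixed vector \<open>u - v\<close>
  passes under the integral by linearity.\<close>

lemma A_bar_mult_diff:
  fixes f :: "real^'n \<Rightarrow> real^'n"
  assumes "Ck 1 f"
  shows "A_bar f u v *v (u - v) = f u - f v"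
proof -
  let ?p = "\<lambda>\<theta>::real. \<theta> *\<^sub>R u + (1 - \<theta>) *\<^sub>R v"
  have "continuous_on {0..1} (\<lambda>\<theta>. A_mat f (?p \<theta>))"
    by (rule continuous_on_compose2[OF continuous_on_A_mat[OF assms]]) (auto intro!: continuous_intros)
  then have "A_bar f u v *v (u - v) = integral {0..1} (\<lambda>\<theta>. A_mat f (?p \<theta>) *v (u - v))"
    unfolding A_bar_def
    using integral_linear[OF integrable_continuous_real bounded_linear_matrix_vector_mult_left]
    by (force simp: o_def)
  moreover have "((\<lambda>\<theta>. A_mat f (?p \<theta>) *v (u - v)) has_integral f (?p 1) - f (?p 0)) {0..1}"
  proof (rule fundamental_theorem_of_calculus)
    fix \<theta> :: real
    have "(?p has_derivative (\<lambda>h. h *\<^sub>R (u - v))) (at \<theta> within {0..1})"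
      by (auto intro!: derivative_eq_intros simp: algebra_simps)
    from has_derivative_compose[OF this has_derivative_A_mat[OF assms]]
    show "((\<lambda>\<theta>. f (?p \<theta>)) has_vector_derivative A_mat f (?p \<theta>) *v (u - v)) (at \<theta> within {0..1})"
      by (simp add: has_vector_derivative_def matrix_vector_mult_scaleR)
  qed simp
  ultimately show ?thesis
    by (simp add: integral_unique)
qed

text \<open>The product rule is applied to both sides of one scalar identity, and derivatives are
  unique. Since the identity is differentiated, \<open>ev\<close> is required at every pair, not
  only at \<open>(a, b)\<close>.\<close>

lemma derivative_of_eigen_identity:
  fixes f :: "real^'n \<Rightarrow> real^'n"
  assumes f: "Ck 1 f" and lam: "Ck 1 lam" and l: "Ck 1 l"
    and ev: "\<And>p. l p v* A_bar f (fst p) (snd p) = lam p *\<^sub>R l p"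
  shows "frechet_derivative l (at (a, b)) (w, z) \<bullet> (f a - f b)
       + l (a, b) \<bullet> (A_mat f a *v w - A_mat f b *v z)
     = frechet_derivative lam (at (a, b)) (w, z) * (l (a, b) \<bullet> (a - b))
       + lam (a, b) * (frechet_derivative l (at (a, b)) (w, z) \<bullet> (a - b) + l (a, b) \<bullet> (w - z))"
    (is "?lhs (w, z) = ?rhs (w, z)")
proof -
  note ders = has_derivative_compose[OF has_derivative_fst[OF has_derivative_ident] has_derivative_A_mat[OF f]]
    has_derivative_compose[OF has_derivative_snd[OF has_derivative_ident] has_derivative_A_mat[OF f]]
  let ?g = "\<lambda>p. l p \<bullet> (f (fst p) - f (snd p))"
  let ?h = "\<lambda>p. lam p * (l p \<bullet> (fst p - snd p))"
  have "?g = ?h"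
  proof
    fix p
    have "?g p = (l p v* A_bar f (fst p) (snd p)) \<bullet> (fst p - snd p)"
      by (simp add: dot_lmul_matrix A_bar_mult_diff[OF f])
    then show "?g p = ?h p"
      by (simp add: ev)
  qed
  let ?G = "\<lambda>q. l (a, b) \<bullet> (A_mat f a *v fst q - A_mat f b *v snd q)
      + frechet_derivative l (at (a, b)) q \<bullet> (f a - f b)"
  let ?H = "\<lambda>q. lam (a, b) * (l (a, b) \<bullet> (fst q - snd q) + frechet_derivative l (at (a, b)) q \<bullet> (a - b))
      + frechet_derivative lam (at (a, b)) q * (l (a, b) \<bullet> (a - b))"
  have "(?g has_derivative ?G) (at (a, b))"
    using has_derivative_inner[OF Ck_1D(1)[OF l] has_derivative_diff[OF ders], of "(a, b)"] by simp
  moreover have "(?h has_derivative ?H) (at (a, b))"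
    using has_derivative_mult[OF Ck_1D(1)[OF lam] has_derivative_inner[OF Ck_1D(1)[OF l]
        has_derivative_diff[OF has_derivative_fst[OF has_derivative_ident]
          has_derivative_snd[OF has_derivative_ident]]], of "(a, b)"] by simp
  ultimately have "?G = ?H"
    unfolding \<open>?g = ?h\<close> by (rule has_derivative_unique)
  from fun_cong[OF this, of "(w, z)"] show ?thesis
    by (simp add: algebra_simps)
qed

section \<open>One-sided limits in the moving coordinate\<close>

text \<open>The filters in \<open>x\<close> and in \<open>y = x - a\<close> are restricted to points
  of differentiability; a translation has to match these two sets.\<close>

lemma differentiable_at_shift_iff:
  fixes g :: "real \<Rightarrow> 'a::real_normed_vector"
  shows "(\<lambda>y. g (a + y)) differentiable (at y) \<longleftrightarrow> g differentiable (at (a + y))"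
proof
  assume "(\<lambda>y. g (a + y)) differentiable (at y)"
  then have "((\<lambda>y. g (a + y)) \<circ> (\<lambda>x. x - a)) differentiable (at (a + y))"
    by (intro differentiable_chain_at) (auto intro!: derivative_intros)
  then show "g differentiable (at (a + y))"
    by (simp add: o_def)
next
  assume "g differentiable (at (a + y))"
  then have "(g \<circ> (\<lambda>y. a + y)) differentiable (at y)"
    by (intro differentiable_chain_at) (auto intro!: derivative_intros)
  then show "(\<lambda>y. g (a + y)) differentiable (at y)"
    by (simp add: o_def)
qed

lemma filterlim_diff_right_shift:
  "filterlim (\<lambda>y. a + y) (diff_right g a) (diff_right (\<lambda>y. g (a + y)) 0)"
  unfolding diff_right_def filterlim_at
  by (auto simp: eventually_at_filter differentiable_at_shift_iff intro!: tendsto_eq_intros)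

lemma filterlim_diff_left_shift:
  "filterlim (\<lambda>y. a + y) (diff_left g a) (diff_left (\<lambda>y. g (a + y)) 0)"
  unfolding diff_left_def filterlim_at
  by (auto simp: eventually_at_filter differentiable_at_shift_iff intro!: tendsto_eq_intros)

text \<open>The filters \<open>F\<close> (in \<open>x\<close>) and \<open>G\<close> (in
  \<open>y\<close>) are arbitrary, so that one argument covers both sides of the curve.\<close>

lemma tendsto_moving_flux:
  fixes f :: "real^'n \<Rightarrow> real^'n"
  assumes f: "Ck 1 f" and shift: "filterlim (\<lambda>y. xc t + y) F G"
    and u: "(u t \<longlongrightarrow> a) F" and w: "(w t \<longlongrightarrow> b) F"
  shows "(moving_flux f u w xc \<xi> t \<longlongrightarrow> A_mat f a *v b - deriv xc t *\<^sub>R b - deriv \<xi> t *\<^sub>R a) G"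
proof -
  have u': "((\<lambda>y. u t (xc t + y)) \<longlongrightarrow> a) G" and w': "((\<lambda>y. w t (xc t + y)) \<longlongrightarrow> b) G"
    using filterlim_compose[OF u shift] filterlim_compose[OF w shift] .
  have "((\<lambda>y. A_mat f (u t (xc t + y))) \<longlongrightarrow> A_mat f a) G"
    using continuous_on_tendsto_compose[OF continuous_on_A_mat[OF f] u'] by simp
  then have "((\<lambda>y. A_mat f (u t (xc t + y)) *v w t (xc t + y)) \<longlongrightarrow> A_mat f a *v b) G"
    using w' unfolding matrix_vector_mult_def by (intro tendsto_intros)
  then show ?thesis
    unfolding moving_flux_def using u' w' by (intro tendsto_intros)
qed

section \<open>Shift equation, interface conditions and flux at the discontinuity\<close>

theorem theorem3p1:
  fixes f :: "real^'n \<Rightarrow> real^'n"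
    and lam :: "nat \<Rightarrow> (real^'n) \<times> (real^'n) \<Rightarrow> real"
    and l :: "nat \<Rightarrow> (real^'n) \<times> (real^'n) \<Rightarrow> real^'n"
    and T :: "real set"
    and B :: "'b set" and X :: "'b \<Rightarrow> real \<Rightarrow> real" and \<alpha> :: 'b and k :: nat
    and u v :: "real \<Rightarrow> real \<Rightarrow> real^'n"
    and up um wp wm :: "real \<Rightarrow> real^'n"
    and \<xi> :: "real \<Rightarrow> real"
  assumes "smooth f"
    and "strictly_hyperbolic f"
    and "averaged_eigenstructure f lam l"
    and "lax_fields f lam"
    and "open T" and "is_interval T"
    and "piecewise_lipschitz T B X u"
    and "weak_solution f T u"
    and "\<alpha> \<in> B"
    and "k \<in> {1..CARD('n)}"
    and "\<And>t. t \<in> T \<Longrightarrow> (u t \<longlongrightarrow> up t) (at_right (X \<alpha> t))"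
    and "\<And>t. t \<in> T \<Longrightarrow> (u t \<longlongrightarrow> um t) (at_left (X \<alpha> t))"
    and "\<And>t. t \<in> T \<Longrightarrow> up t \<noteq> um t"
    and "\<And>t. t \<in> T \<Longrightarrow> belongs_to_family lam l k (X \<alpha>) t (up t) (um t)"
    and "\<xi> differentiable_on T"
    and "\<And>t. t \<in> T \<Longrightarrow> (w_var u v \<xi> t \<longlongrightarrow> wp t) (diff_right (u t) (X \<alpha> t))"
    and "\<And>t. t \<in> T \<Longrightarrow> (w_var u v \<xi> t \<longlongrightarrow> wm t) (diff_left (u t) (X \<alpha> t))"
    and "t \<in> T"
  shows
    "(\<exists>!lk. is_left_eigenvector (A_bar f (up t) (um t)) (lam k (up t, um t)) lk
           \<and> lk \<bullet> (up t - um t) = 1) \<and>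
     (\<forall>lk. is_left_eigenvector (A_bar f (up t) (um t)) (lam k (up t, um t)) lk
           \<and> lk \<bullet> (up t - um t) = 1 \<longrightarrow>
        (deriv \<xi> t = frechet_derivative (lam k) (at (up t, um t)) (wp t, wm t) \<longleftrightarrow>
         deriv \<xi> t = lk \<bullet> ((A_mat f (up t) - A_bar f (up t) (um t)) *v wp t
                        + (A_bar f (up t) (um t) - A_mat f (um t)) *v wm t))) \<and>
     (deriv (X \<alpha>) t *\<^sub>R wp t - A_mat f (up t) *v wp t + deriv \<xi> t *\<^sub>R up t
        = deriv (X \<alpha>) t *\<^sub>R wm t - A_mat f (um t) *v wm t + deriv \<xi> t *\<^sub>R um t \<longrightarrow>
      (\<forall>i\<in>{1..CARD('n)}. i \<noteq> k \<longrightarrow>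
         l i (up t, um t) \<bullet> (wp t - wm t)
         + frechet_derivative (l i) (at (up t, um t)) (wp t, wm t) \<bullet> (up t - um t) = 0) \<and>
      (\<exists>\<Phi>. (moving_flux f u (w_var u v \<xi>) (X \<alpha>) \<xi> t \<longlongrightarrow> \<Phi>)
               (diff_right (\<lambda>y. u t (X \<alpha> t + y)) 0) \<and>
           (moving_flux f u (w_var u v \<xi>) (X \<alpha>) \<xi> t \<longlongrightarrow> \<Phi>)
               (diff_left (\<lambda>y. u t (X \<alpha> t + y)) 0)))"
proof -
  note eigs = assms(3)[unfolded averaged_eigenstructure_def]
  have f: "Ck 1 f"
    using assms(1) by (simp add: smooth_def)
  define I where "I = {1..CARD('n)}"
  have k: "k \<in> I" and fin: "finite I" "card I = CARD('n)"
    using assms(10) by (auto simp: I_def)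
  define a b where "a = up t" and "b = um t"
  define d where "d = a - b"
  define M where "M = A_bar f a b"
  define \<mu> where "\<mu> i = lam i (a, b)" for i
  define L where "L i = l i (a, b)" for i
  have ev: "is_left_eigenvector M (\<mu> i) (L i)" if "i \<in> I" for i
    using eigs that by (auto simp: M_def \<mu>_def L_def I_def)
  have inj: "inj_on \<mu> I"
    using eigs strict_mono_on_imp_inj_on unfolding \<mu>_def I_def by blast
  have "d \<noteq> 0"
    using assms(13)[OF \<open>t \<in> T\<close>] by (simp add: d_def a_def b_def)
  have fam: "deriv (X \<alpha>) t = \<mu> k" "\<And>i. i \<in> I \<Longrightarrow> i \<noteq> k \<Longrightarrow> L i \<bullet> d = 0"
    using assms(14)[OF \<open>t \<in> T\<close>]
    by (auto simp: belongs_to_family_def \<mu>_def L_def I_def a_def b_def d_def DERIV_imp_deriv)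
  have evD: "L i \<bullet> (M *v x) = \<mu> i * (L i \<bullet> x)" if "i \<in> I" for i x
    using ev[OF that] by (simp add: is_left_eigenvector_def flip: dot_lmul_matrix)
  have zero: "x = 0" if "\<And>i. i \<in> I \<Longrightarrow> L i \<bullet> x = 0" for x
    using orthogonal_left_eigenvectors_eq_0[OF ev fin inj that] by blast
  have Lk: "L k \<bullet> d \<noteq> 0"
    using zero[of d] fam(2) \<open>d \<noteq> 0\<close> by metis
  \<comment> \<open>Both sides have the same pairing with every \<open>L i\<close>: for
    \<open>i = k\<close> by the eigenvalue equation, otherwise because both pairings vanish. Thus
    the orthogonality conditions yield the Rankine-Hugoniot relation \<open>fd\<close>.\<close>
  have Md: "M *v d = \<mu> k *\<^sub>R d"
  proof -
    have "L i \<bullet> (M *v d - \<mu> k *\<^sub>R d) = 0" if "i \<in> I" for i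
      using evD[OF that, of d] fam(2)[OF that] by (cases "i = k") (auto simp: inner_diff_right)
    then show ?thesis
      using zero[of "M *v d - \<mu> k *\<^sub>R d"] by simp
  qed
  have fd: "f a - f b = \<mu> k *\<^sub>R d"
    using A_bar_mult_diff[OF f, of a b] Md by (simp add: M_def d_def)
  \<comment> \<open>The given \<open>l k\<close> need not be normalised; \<open>N\<close> is the
    multiple of it whose pairing with the jump is 1.\<close>
  define N where "N = L k /\<^sub>R (L k \<bullet> d)"
  have N: "is_left_eigenvector M (\<mu> k) N" "N \<bullet> d = 1"
    using ev[OF k] Lk by (auto simp: N_def is_left_eigenvector_def scaleR_vector_matrix_assoc)
  have uniq: "K = N" if K: "is_left_eigenvector M (\<mu> k) K" "K \<bullet> d = 1" for K
  proof (rule ccontr)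
    assume "K \<noteq> N"
    \<comment> \<open>otherwise \<open>K - N\<close> could replace \<open>L k\<close> in the eigenbasis, and \<open>d\<close> would be orthogonal to all of it\<close>
    moreover have "(K - N) v* M = \<mu> k *\<^sub>R (K - N)"
      using K N by (simp add: is_left_eigenvector_def vector_matrix_mult_diff_distrib scaleR_diff_right)
    ultimately have "is_left_eigenvector M (\<mu> k) (K - N)"
      by (simp add: is_left_eigenvector_def)
    then have "is_left_eigenvector M (\<mu> i) ((L(k := K - N)) i)" if "i \<in> I" for i
      using ev[OF that] by simp
    moreover have "(L(k := K - N)) i \<bullet> d = 0" if "i \<in> I" for i
      using fam(2)[OF that] K N by (simp add: inner_diff_left)
    ultimately show False
      using orthogonal_left_eigenvectors_eq_0[of I M \<mu> "L(k := K - N)" d] fin inj \<open>d \<noteq> 0\<close> by blast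
  qed
  define P Q where "P = wp t" and "Q = wm t"
  define dlam where "dlam i = frechet_derivative (lam i) (at (a, b)) (P, Q)" for i
  define dl where "dl i = frechet_derivative (l i) (at (a, b)) (P, Q)" for i
  \<comment> \<open>Replacing \<open>f a - f b\<close> by \<open>fd\<close> puts the factor
    \<open>\<mu> k\<close> on the left, while the right keeps \<open>\<mu> i\<close>. This mismatch
    separates the case \<open>i = k\<close> from the others.\<close>
  have deriv_id: "\<mu> k * (dl i \<bullet> d) + L i \<bullet> (A_mat f a *v P - A_mat f b *v Q)
      = dlam i * (L i \<bullet> d) + \<mu> i * (dl i \<bullet> d + L i \<bullet> (P - Q))" if "i \<in> I" for i
  proof -
    have "Ck 1 (lam i)" "Ck 1 (l i)"
      and "\<And>p. l i p v* A_bar f (fst p) (snd p) = lam i p *\<^sub>R l i p"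
      using eigs that by (auto simp: I_def is_left_eigenvector_def)
    from derivative_of_eigen_identity[OF f this, of a b P Q] show ?thesis
      unfolding fd by (simp add: dlam_def dl_def \<mu>_def L_def d_def)
  qed
  \<comment> \<open>For \<open>i = k\<close> the two terms with \<open>dl k\<close> cancel. The
    eigenvalue is then absorbed into \<open>M\<close> through \<open>evD\<close>, and division by
    \<open>L k \<bullet> d\<close> turns \<open>L k\<close> into \<open>N\<close>.\<close>
  have dlam_k: "dlam k = N \<bullet> ((A_mat f a - M) *v P + (M - A_mat f b) *v Q)"
  proof -
    have "dlam k * (L k \<bullet> d) = L k \<bullet> (A_mat f a *v P - A_mat f b *v Q) - \<mu> k * (L k \<bullet> (P - Q))"
      using deriv_id[OF k] by (simp add: algebra_simps)
    also have "\<dots> = L k \<bullet> ((A_mat f a - M) *v P + (M - A_mat f b) *v Q)"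
      unfolding evD[OF k, symmetric]
      by (simp add: matrix_vector_mult_diff_rdistrib matrix_vector_mult_diff_distrib inner_simps)
    finally show ?thesis
      using Lk by (simp add: N_def field_simps)
  qed
  let ?rel = "deriv (X \<alpha>) t *\<^sub>R P - A_mat f a *v P + deriv \<xi> t *\<^sub>R a
    = deriv (X \<alpha>) t *\<^sub>R Q - A_mat f b *v Q + deriv \<xi> t *\<^sub>R b"
  \<comment> \<open>Orthogonality of \<open>L i\<close> to \<open>d\<close> removes both the
    \<open>deriv \<xi> t\<close> term and the \<open>dlam i\<close> term; what is left is the claim
    times \<open>\<mu> k - \<mu> i\<close>, which is nonzero.\<close>
  have interface: "L i \<bullet> (P - Q) + dl i \<bullet> d = 0"
    if rel: ?rel and i: "i \<in> I" "i \<noteq> k" for i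
  proof -
    have "A_mat f a *v P - A_mat f b *v Q = \<mu> k *\<^sub>R (P - Q) + deriv \<xi> t *\<^sub>R d"
      using rel unfolding fam(1) by (simp add: d_def algebra_simps)
    then have "L i \<bullet> (A_mat f a *v P - A_mat f b *v Q) = \<mu> k * (L i \<bullet> (P - Q))"
      using fam(2)[OF i] by (simp add: inner_add_right)
    then have "(\<mu> k - \<mu> i) * (L i \<bullet> (P - Q) + dl i \<bullet> d) = 0"
      using deriv_id[OF i(1)] fam(2)[OF i] by (simp add: algebra_simps)
    then show ?thesis
      using inj i k by (auto simp: inj_on_def)
  qed
  have right: "(moving_flux f u (w_var u v \<xi>) (X \<alpha>) \<xi> t
      \<longlongrightarrow> A_mat f a *v P - deriv (X \<alpha>) t *\<^sub>R P - deriv \<xi> t *\<^sub>R a)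
        (diff_right (\<lambda>y. u t (X \<alpha> t + y)) 0)"
  proof (rule tendsto_moving_flux[OF f filterlim_diff_right_shift])
    \<comment> \<open>The limit of \<open>u t\<close> along all points to the right persists along
      the points of differentiability among them.\<close>
    show "(u t \<longlongrightarrow> a) (diff_right (u t) (X \<alpha> t))"
      unfolding a_def diff_right_def
      by (rule tendsto_within_subset[OF assms(11)[OF \<open>t \<in> T\<close>]]) auto
    show "(w_var u v \<xi> t \<longlongrightarrow> P) (diff_right (u t) (X \<alpha> t))"
      unfolding P_def by (rule assms(16)[OF \<open>t \<in> T\<close>])
  qed
  have left: "(moving_flux f u (w_var u v \<xi>) (X \<alpha>) \<xi> t
      \<longlongrightarrow> A_mat f b *v Q - deriv (X \<alpha>) t *\<^sub>R Q - deriv \<xi> t *\<^sub>R b)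
        (diff_left (\<lambda>y. u t (X \<alpha> t + y)) 0)"
  proof (rule tendsto_moving_flux[OF f filterlim_diff_left_shift])
    show "(u t \<longlongrightarrow> b) (diff_left (u t) (X \<alpha> t))"
      unfolding b_def diff_left_def
      by (rule tendsto_within_subset[OF assms(12)[OF \<open>t \<in> T\<close>]]) auto
    show "(w_var u v \<xi> t \<longlongrightarrow> Q) (diff_left (u t) (X \<alpha> t))"
      unfolding Q_def by (rule assms(17)[OF \<open>t \<in> T\<close>])
  qed
  have flux: "\<exists>\<Phi>. (moving_flux f u (w_var u v \<xi>) (X \<alpha>) \<xi> t \<longlongrightarrow> \<Phi>)
               (diff_right (\<lambda>y. u t (X \<alpha> t + y)) 0) \<and>
           (moving_flux f u (w_var u v \<xi>) (X \<alpha>) \<xi> t \<longlongrightarrow> \<Phi>)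
               (diff_left (\<lambda>y. u t (X \<alpha> t + y)) 0)" (is ?flux)
    if ?rel
  proof -
    \<comment> \<open>The two one-sided limits of the flux are the negatives of the two sides of the
      assumed relation.\<close>
    have "A_mat f a *v P - deriv (X \<alpha>) t *\<^sub>R P - deriv \<xi> t *\<^sub>R a
        = A_mat f b *v Q - deriv (X \<alpha>) t *\<^sub>R Q - deriv \<xi> t *\<^sub>R b"
      using arg_cong[OF that, of uminus] by (simp add: algebra_simps)
    then show ?thesis
      using right left by metis
  qed
  note vars = M_def \<mu>_def L_def d_def dlam_def dl_def P_def Q_def a_def b_def I_def
  have part1: "\<exists>!lk. is_left_eigenvector M (\<mu> k) lk \<and> lk \<bullet> d = 1"
    using N uniq by blast
  \<comment> \<open>Every admissible \<open>lk\<close> is \<open>N\<close>, and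
    \<open>dlam_k\<close> says that the two right-hand sides are equal, so the equivalence holds
    whatever the value of \<open>deriv \<xi> t\<close>.\<close>
  have part2: "\<forall>lk. is_left_eigenvector M (\<mu> k) lk \<and> lk \<bullet> d = 1 \<longrightarrow>
      (deriv \<xi> t = dlam k \<longleftrightarrow>
       deriv \<xi> t = lk \<bullet> ((A_mat f a - M) *v P + (M - A_mat f b) *v Q))"
    using uniq dlam_k by metis
  have part3: "?rel \<longrightarrow> (\<forall>i\<in>I. i \<noteq> k \<longrightarrow> L i \<bullet> (P - Q) + dl i \<bullet> d = 0) \<and> ?flux"
    using interface flux by (intro impI conjI ballI)
  show ?thesis
    by (intro conjI part1[unfolded vars] part2[unfolded vars] part3[unfolded vars])
qed

end
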